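(* Let $A\in\mathbb{R}^{m\times n}$ with $n\ge 2$ have full column rank, let $b\in\mathbb{R}^m$, and let $x_\star=A^{\dagger}b=(A^TA)^{-1}A^Tb$ be the unique minimizer of $\|b-Ax\|_2^2$ over $x\in\mathbb{R}^n$. Let $x_0\in\mathbb{R}^n$ be an arbitrary initial guess, and let $\{x_k\}_{k=0}^\infty$ be any sequence generated from $x_0$ by the greedy Gauss-Seidel (GGS) method, with associated index sets $\mathcal{R}_k$ (method and index sets as defined in the context). Then $\{x_k\}_{k=0}^\infty$ converges linearly to $x_\star$, and $$\|x_1-x_\star\|_{A^TA}^2\le\left(1-\frac{1}{|\mathcal{R}_0|}\cdot\frac{1}{\sum_{j\in\mathcal{R}_0}\|A_{(j)}\|_2^2}\cdot\frac1n\cdot\lambda_{\min}(A^TA)\right)\|x_0-x_\star\|_{A^TA}^2,$$ and, for every $k=1,2,\ldots$, $$\|x_{k+1}-x_\star\|_{A^TA}^2\le\left(1-\frac{1}{|\mathcal{R}_k|}\cdot\frac{1}{\sum_{j\in\mathcal{R}_k}\|A_{(j)}\|_2^2}\cdot\frac1{n-1}\cdot\lambda_{\min}(A^TA)\right)\|x_k-x_\star\|_{A^TA}^2.$$ Moreover, let $\alpha=\max_{k\ge 0}|\mathcal{R}_k|$ and $\beta=\max_{k\ge 0}\sum_{j\in\mathcal{R}_k}\|A_{(j)}\|_2^2$. Then, for every $k=1,2,\ldots$, $$\|x_k-x_\star\|_{A^TA}^2\le\left(1-\frac{\lambda_{\min}(A^TA)}{\alpha\cdot\beta\cdot(n-1)}\right)^{k-1}\left(1-\frac{\lambda_{\min}(A^TA)}{|\mathcal{R}_0|\cdot\sum_{j\in\mathcal{R}_0}\|A_{(j)}\|_2^2\cdot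 n}\right)\|x_0-x_\star\|_{A^TA}^2.$$
   Context: Notation: $A_{(j)}$ is the $j$th column of $A$, and $A_{(j)}^T$ is its transpose; $e_j$ is the $j$th column of the $n\times n$ identity matrix; $|\mathcal{W}|$ is the number of elements of a finite set $\mathcal{W}$. For a positive definite matrix $G\in\mathbb{R}^{n\times n}$, the energy norm is $\|x\|_G:=\sqrt{x^TGx}$. $\lambda_{\min}(A^TA)$ is the smallest positive eigenvalue of $A^TA$. $A^{\dagger}$ is the Moore-Penrose pseudoinverse of $A$, which equals $(A^TA)^{-1}A^T$ when $A$ has full column rank. Greedy Gauss-Seidel (GGS) method. Input: $A\in\mathbb{R}^{m\times n}$, $b\in\mathbb{R}^m$, and an initial estimate $x_0\in\mathbb{R}^n$. For $k=0,1,2,\ldots$, with $r_k:=b-Ax_k$, do the following: (1) Determine the index set $$\mathcal{R}_k=\left\{\tilde j\in\{1,\ldots,n\} : |A_{(\tilde j)}^Tr_k|=\max_{1\le j\le n}|A_{(j)}^Tr_k|\right\}.$$ (2) Choose an index $$j_k\in\arg\max_{\tilde j\in\mathcal{R}_k}\left\{\frac{|A_{(\tilde j)}^Tr_k|^2}{\|A_{(\tilde j)}\|_2^2}\right\}$$ (any maximizer). (3) Set $$x_{k+1}=x_k+\frac{A_{(j_k)}^Tr_k}{\|A_{(j_k)}\|_2^2}\,e_{j_k}.$$ *)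

theory Defs
  imports "HOL-Analysis.Analysis"
begin

text \<open>A matrix with \<open>m\<close> rows and \<open>n\<close> columns is an element of \<^typ>\<open>real^'n^'m\<close>, so that
  \<open>n = CARD('n)\<close> and \<open>m = CARD('m)\<close>.\<close>

definition energy_norm :: "real^'n^'n \<Rightarrow> real^'n \<Rightarrow> real" where
  "energy_norm G x = sqrt (x \<bullet> (G *v x))"

definition is_eigenvalue :: "real^'n^'n \<Rightarrow> real \<Rightarrow> bool" where
  "is_eigenvalue M l \<longleftrightarrow> (\<exists>v. v \<noteq> 0 \<and> M *v v = l *\<^sub>R v)"

definition lambda_min :: "real^'n^'n \<Rightarrow> real" where
  "lambda_min M = (LEAST l. 0 < l \<and> is_eigenvalue M l)"

text \<open>The Moore-Penrose pseudoinverse, as the unique solution of the four Penrose equations.\<close>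

definition is_pseudoinverse :: "real^'n^'m \<Rightarrow> real^'m^'n \<Rightarrow> bool" where
  "is_pseudoinverse A X \<longleftrightarrow>
     A ** X ** A = A \<and> X ** A ** X = X \<and>
     transpose (A ** X) = A ** X \<and> transpose (X ** A) = X ** A"

definition pseudoinverse :: "real^'n^'m \<Rightarrow> real^'m^'n" where
  "pseudoinverse A = (THE X. is_pseudoinverse A X)"

text \<open>Linear convergence is understood as convergence with a uniform contraction factor
  for the error, measured by the function \<open>N\<close> (below, an energy norm).\<close>

definition converges_linearly ::
    "('a::real_normed_vector \<Rightarrow> real) \<Rightarrow> (nat \<Rightarrow> 'a) \<Rightarrow> 'a \<Rightarrow> bool" where
  "converges_linearly N x L \<longleftrightarrow>
     x \<longlonglongrightarrow> L \<and>
     (\<exists>q. 0 \<le> q \<and> q < 1 \<and> (\<forall>k. N (x (Suc k) - L) \<le> q * N (x k - L)))"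

text \<open>The index set \<open>\<R>\<^sub>k\<close> of the greedy Gauss-Seidel method depends only on the current
  iterate \<open>x\<close>, through the residual \<open>b - A x\<close>.\<close>

definition GGS_index_set :: "real^'n^'m \<Rightarrow> real^'m \<Rightarrow> real^'n \<Rightarrow> 'n set" where
  "GGS_index_set A b x =
     {i. \<bar>column i A \<bullet> (b - A *v x)\<bar> = Max (range (\<lambda>j. \<bar>column j A \<bullet> (b - A *v x)\<bar>))}"

definition GGS_step :: "real^'n^'m \<Rightarrow> real^'m \<Rightarrow> real^'n \<Rightarrow> real^'n \<Rightarrow> bool" where
  "GGS_step A b x x' \<longleftrightarrow>
     (\<exists>j. is_arg_max (\<lambda>i. \<bar>column i A \<bullet> (b - A *v x)\<bar>\<^sup>2 / (norm (column i A))\<^sup>2)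
            (\<lambda>i. i \<in> GGS_index_set A b x) j \<and>
          x' = x + ((column j A \<bullet> (b - A *v x)) / (norm (column j A))\<^sup>2) *\<^sub>R axis j 1)"

definition GGS_sequence :: "real^'n^'m \<Rightarrow> real^'m \<Rightarrow> real^'n \<Rightarrow> (nat \<Rightarrow> real^'n) \<Rightarrow> bool" where
  "GGS_sequence A b x0 x \<longleftrightarrow> x 0 = x0 \<and> (\<forall>k. GGS_step A b (x k) (x (Suc k)))"

end

theory Submission imports Defs begin

text \<open>Put \<open>g = A\<^sup>T (b - A x)\<close> and \<open>e = x - x\<^sub>\<star>\<close>, so that \<open>g = - A\<^sup>T A e\<close> and the energy norm of \<open>e\<close>
  is the Euclidean norm of \<open>A e\<close>. A step along the coordinate \<open>j\<close> is an exact line search: it lowers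
  the squared energy norm by \<open>g\<^sub>j\<^sup>2 / \<parallel>A\<^sub>j\<parallel>\<^sup>2\<close> and makes the \<open>j\<close>th entry of the next \<open>g\<close> vanish. The
  greedy choice gives \<open>g\<^sub>j\<^sup>2 \<ge> \<parallel>g\<parallel>\<^sup>2 / s\<close> whenever \<open>g\<close> has at most \<open>s\<close> nonzero entries, which means
  \<open>s = n\<close> at the start and \<open>s = n - 1\<close> afterwards. Finally \<open>\<parallel>g\<parallel>\<^sup>2 \<ge> \<lambda>\<^sub>m\<^sub>i\<^sub>n \<parallel>A e\<parallel>\<^sup>2\<close> by the Rayleigh
  quotient bound and the Cauchy-Schwarz inequality.\<close>

section \<open>Smallest eigenvalue and the Rayleigh quotient\<close>

text \<open>With w = M v, the form at v + t w is a polynomial in t without constant term and with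
  linear coefficient 2 (w . w). It is nonnegative for every t, so this coefficient must vanish. This
  replaces a differentiation argument when a Rayleigh minimizer is shown to be an
  eigenvector.\<close>

lemma psd_inner_eq_0_imp_mult_eq_0:
  fixes M :: "real^'n^'n"
  assumes sym: "transpose M = M" and psd: "\<And>x. 0 \<le> x \<bullet> (M *v x)" and v: "v \<bullet> (M *v v) = 0"
  shows "M *v v = 0"
proof -
  define w where "w = M *v v"
  define c where "c = w \<bullet> (M *v w)"
  have vw: "v \<bullet> (M *v w) = w \<bullet> w"
    unfolding w_def by (metis dot_lmul_matrix sym transpose_matrix_vector)
  have q: "0 \<le> t * (2 * (w \<bullet> w)) + t\<^sup>2 * c" for t
  proof -
    have "0 \<le> (v + t *\<^sub>R w) \<bullet> (M *v (v + t *\<^sub>R w))" by (rule psd)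
    also have "\<dots> = t * (2 * (w \<bullet> w)) + t\<^sup>2 * c"
      using v vw w_def c_def
      by (simp add: matrix_vector_right_distrib matrix_vector_mult_scaleR inner_add_left
          inner_add_right power2_eq_square algebra_simps)
    finally show ?thesis .
  qed
  have c0: "0 \<le> c" unfolding c_def by (rule psd)
  have "w \<bullet> w = 0"
  proof (rule ccontr)
    assume "w \<bullet> w \<noteq> 0"
    then have ww: "0 < w \<bullet> w" by simp
    \<comment> \<open>The point t = -s makes the polynomial negative. The summand 1 keeps the
      denominator positive when c = 0 and still gives s c < w . w.\<close>
    define s where "s = (w \<bullet> w) / (c + 1)"
    have s: "0 < s" "s * c < 2 * (w \<bullet> w)"
      using ww c0 by (auto simp: s_def field_simps add_strict_increasing)
    have "0 \<le> s * (s * c - 2 * (w \<bullet> w))"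
      using q[of "- s"] by (simp add: power2_eq_square algebra_simps)
    with s show False by (simp add: zero_le_mult_iff)
  qed
  then show ?thesis unfolding w_def by simp
qed

text \<open>By compactness the form attains its minimum \<mu> on the unit sphere. The matrix M -
  \<mu> I is positive semidefinite and its form vanishes at the minimizer, which is therefore an
  eigenvector for \<mu>. Every eigenvalue is a Rayleigh quotient, so \<mu> is the least one and the
  \<open>LEAST\<close> in \<open>lambda_min\<close> is attained.\<close>

lemma lambda_min_pos_def:
  fixes M :: "real^'n^'n"
  assumes sym: "transpose M = M" and pos: "\<And>x. x \<noteq> 0 \<Longrightarrow> 0 < x \<bullet> (M *v x)"
  shows "0 < lambda_min M" and "lambda_min M * (x \<bullet> x) \<le> x \<bullet> (M *v x)"
proof -
  have cont: "continuous_on (sphere 0 1) (\<lambda>x. x \<bullet> (M *v x))"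
    by (intro continuous_intros linear_continuous_on matrix_vector_mul_bounded_linear)
  have "sphere (0::real^'n) 1 \<noteq> {}" by simp
  then obtain v where v: "norm v = 1"
    and v_min: "\<And>y. norm y = 1 \<Longrightarrow> v \<bullet> (M *v v) \<le> y \<bullet> (M *v y)"
    using continuous_attains_inf[OF compact_sphere _ cont] by (auto simp: sphere_def dist_norm)
  define \<mu> where "\<mu> = v \<bullet> (M *v v)"
  have v0: "v \<noteq> 0" using v by auto
  then have \<mu>0: "0 < \<mu>" unfolding \<mu>_def by (rule pos)
  have rayleigh: "\<mu> * (y \<bullet> y) \<le> y \<bullet> (M *v y)" for y
  proof (cases "y = 0")
    case False
    have "\<mu> \<le> (y /\<^sub>R norm y) \<bullet> (M *v (y /\<^sub>R norm y))"
      unfolding \<mu>_def using False by (intro v_min) simp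
    also have "\<dots> = (y \<bullet> (M *v y)) / (y \<bullet> y)"
      by (simp add: matrix_vector_mult_scaleR dot_square_norm power2_eq_square divide_simps)
    finally show ?thesis using False by (simp add: field_simps)
  qed simp
  define H where "H = M - \<mu> *\<^sub>R mat 1"
  have H: "H *v y = M *v y - \<mu> *\<^sub>R y" for y
    unfolding H_def by (simp add: matrix_vector_mult_diff_rdistrib scaleR_matrix_vector_assoc[symmetric])
  have "H *v v = 0"
  proof (rule psd_inner_eq_0_imp_mult_eq_0)
    show "transpose H = H"
      using sym unfolding H_def transpose_def mat_def by (auto simp: vec_eq_iff)
    show "0 \<le> y \<bullet> (H *v y)" for y
      using rayleigh[of y] by (simp add: H inner_diff_right)
    show "v \<bullet> (H *v v) = 0"
      using v by (simp add: H inner_diff_right \<mu>_def[symmetric] dot_square_norm)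
  qed
  then have eig: "is_eigenvalue M \<mu>"
    unfolding is_eigenvalue_def using v0 H[of v] by auto
  have "\<mu> \<le> l" if l: "is_eigenvalue M l" for l
  proof -
    obtain y where y: "y \<noteq> 0" "M *v y = l *\<^sub>R y"
      using l unfolding is_eigenvalue_def by blast
    then show ?thesis using rayleigh[of y] by simp
  qed
  then have "lambda_min M = \<mu>"
    unfolding lambda_min_def using \<mu>0 eig by (intro Least_equality) auto
  then show "0 < lambda_min M" "lambda_min M * (x \<bullet> x) \<le> x \<bullet> (M *v x)"
    using \<mu>0 rayleigh by auto
qed

section \<open>The Gram matrix of a matrix with full column rank\<close>

lemma gram_inner: "x \<bullet> ((transpose A ** A) *v y) = (A *v x) \<bullet> (A *v y)"
  for A :: "real^'n^'m"
  by (metis dot_lmul_matrix inner_commute matrix_vector_mul_assoc transpose_matrix_vector)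

lemma energy_norm_gram: "energy_norm (transpose A ** A) x = norm (A *v x)"
  for A :: "real^'n^'m"
  by (simp add: energy_norm_def gram_inner norm_eq_sqrt_inner)

lemma transpose_gram: "transpose (transpose A ** A) = transpose A ** A"
  for A :: "real^'n^'m"
  by (simp add: matrix_transpose_mul)

lemma transpose_mult_component: "(transpose A *v r) $ i = column i A \<bullet> r"
  for A :: "real^'n^'m"
  by (simp add: matrix_vector_mul_component row_def[symmetric] transpose_def column_def)

lemma full_rank_mult_eq_0:
  fixes A :: "real^'n^'m"
  assumes "rank A = CARD('n)"
  shows "A *v x = 0 \<longleftrightarrow> x = 0"
  using assms full_rank_injective[of A] by (metis injD matrix_vector_mult_0_right)

lemma full_rank_column_nonzero:
  fixes A :: "real^'n^'m"
  assumes "rank A = CARD('n)"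
  shows "column j A \<noteq> 0"
  using full_rank_mult_eq_0[OF assms, of "axis j 1"] by (simp add: matrix_vector_mult_basis axis_eq_0_iff)

lemma lambda_min_gram:
  fixes A :: "real^'n^'m"
  assumes "rank A = CARD('n)"
  shows "0 < lambda_min (transpose A ** A)"
    and "lambda_min (transpose A ** A) * (norm x)\<^sup>2 \<le> (norm (A *v x))\<^sup>2"
proof -
  have pos: "0 < y \<bullet> ((transpose A ** A) *v y)" if "y \<noteq> 0" for y
    using that full_rank_mult_eq_0[OF assms] by (simp add: gram_inner)
  have "0 < lambda_min (transpose A ** A)"
    and "lambda_min (transpose A ** A) * (x \<bullet> x) \<le> x \<bullet> ((transpose A ** A) *v x)"
    by (rule lambda_min_pos_def[OF transpose_gram pos], assumption)+
  then show "0 < lambda_min (transpose A ** A)"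
    and "lambda_min (transpose A ** A) * (norm x)\<^sup>2 \<le> (norm (A *v x))\<^sup>2"
    by (simp_all only: gram_inner power2_norm_eq_inner)
qed

text \<open>The Rayleigh bound is tested on a unit coordinate vector. The inequality later keeps the
  uniform contraction factor nonnegative.\<close>

lemma lambda_min_gram_le_column:
  fixes A :: "real^'n^'m"
  assumes "rank A = CARD('n)"
  shows "lambda_min (transpose A ** A) \<le> (norm (column j A))\<^sup>2"
  using lambda_min_gram(2)[OF assms, of "axis j 1"] by (simp add: matrix_vector_mult_basis)

text \<open>Let E be the squared norm of A x, and g the transpose of A applied to A x. Then E = x .
  g, so E^2 is at most the product of the squared norms of x and g. Bounding the squared norm of x
  by E / \<open>lambda_min\<close> and cancelling E gives the claim.\<close>

lemma lambda_min_gram_le_gradient: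
  fixes A :: "real^'n^'m"
  assumes "rank A = CARD('n)"
  shows "lambda_min (transpose A ** A) * (norm (A *v x))\<^sup>2 \<le> (norm (transpose A *v (A *v x)))\<^sup>2"
proof (cases "x = 0")
  case False
  define E where "E = (norm (A *v x))\<^sup>2"
  define g where "g = transpose A *v (A *v x)"
  have E: "0 < E" using False full_rank_mult_eq_0[OF assms] by (simp add: E_def)
  have "E = x \<bullet> g"
    by (simp add: E_def g_def gram_inner power2_norm_eq_inner matrix_vector_mul_assoc)
  then have "E\<^sup>2 \<le> (norm x)\<^sup>2 * (norm g)\<^sup>2"
    using Cauchy_Schwarz_ineq[of x g] by (simp add: power2_norm_eq_inner)
  then have "lambda_min (transpose A ** A) * E\<^sup>2 \<le> lambda_min (transpose A ** A) * (norm x)\<^sup>2 * (norm g)\<^sup>2"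
    using lambda_min_gram(1)[OF assms] by (simp add: mult.assoc)
  also have "\<dots> \<le> E * (norm g)\<^sup>2"
    unfolding E_def by (intro mult_right_mono lambda_min_gram(2)[OF assms]) simp
  finally have "E * (lambda_min (transpose A ** A) * E) \<le> E * (norm g)\<^sup>2"
    by (simp add: power2_eq_square mult_ac)
  then show ?thesis
    using E by (simp only: mult_le_cancel_left_pos E_def g_def)
qed simp

section \<open>Pseudoinverse, normal equations and least squares\<close>

lemma full_rank_gram_invertible:
  fixes A :: "real^'n^'m"
  assumes "rank A = CARD('n)"
  shows "invertible (transpose A ** A)"
proof -
  have "x = 0" if "(transpose A ** A) *v x = 0" for x
    using that gram_inner[of x A x] full_rank_mult_eq_0[OF assms] by simp
  then show ?thesis
    by (metis invertible_left_inverse matrix_left_invertible_ker)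
qed

lemma matrix_inv_inverse:
  assumes "invertible M"
  shows "M ** matrix_inv M = mat 1" and "matrix_inv M ** M = mat 1"
  using someI_ex[OF assms[unfolded invertible_def]] unfolding matrix_inv_def by auto

text \<open>The \<open>THE\<close> in \<open>pseudoinverse\<close> requires uniqueness as well as
  existence. For any solution X, symmetry of A X and A X A = A give A^T A X = (A X A)^T = A^T, and
  multiplying by P determines X.\<close>

lemma full_rank_pseudoinverse:
  fixes A :: "real^'n^'m"
  assumes "rank A = CARD('n)"
  shows "pseudoinverse A = matrix_inv (transpose A ** A) ** transpose A"
proof -
  define P where "P = matrix_inv (transpose A ** A)"
  have P: "P ** (transpose A ** A) = mat 1" "(transpose A ** A) ** P = mat 1"
    using full_rank_gram_invertible[OF assms] unfolding P_def
    by (rule matrix_inv_inverse)+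
  \<comment> \<open>Symmetry of A P A^T rests on that of P. Transposing \<open>P(2)\<close> exhibits
    \<open>transpose P\<close> as a left inverse of the Gram matrix, hence equal to P.\<close>
  have P_sym: "transpose P = P"
  proof -
    have "transpose P ** (transpose A ** A) = mat 1"
      by (metis P(2) matrix_transpose_mul transpose_gram transpose_mat)
    then show ?thesis
      by (metis P(2) matrix_mul_assoc matrix_mul_lid matrix_mul_rid)
  qed
  have "is_pseudoinverse A (P ** transpose A)"
    using P unfolding is_pseudoinverse_def
    by (simp add: matrix_mul_assoc matrix_transpose_mul P_sym transpose_mat)
      (metis matrix_mul_assoc matrix_mul_rid)
  moreover have "X = P ** transpose A" if "is_pseudoinverse A X" for X
  proof -
    have "transpose A ** (A ** X) = transpose A ** transpose (A ** X)"
      using that unfolding is_pseudoinverse_def by simp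
    also have "\<dots> = transpose A"
      using that unfolding is_pseudoinverse_def by (metis matrix_transpose_mul)
    finally have "P ** (transpose A ** A) ** X = P ** transpose A"
      by (simp add: matrix_mul_assoc[symmetric])
    then show ?thesis by (simp add: P)
  qed
  ultimately show ?thesis
    unfolding pseudoinverse_def P_def[symmetric] by (rule the_equality)
qed

lemma full_rank_normal_equations:
  fixes A :: "real^'n^'m"
  assumes "rank A = CARD('n)"
  shows "transpose A *v (b - A *v (pseudoinverse A *v b)) = 0"
proof -
  have "(transpose A ** A) ** matrix_inv (transpose A ** A) = mat 1"
    by (rule matrix_inv_inverse(1)[OF full_rank_gram_invertible[OF assms]])
  then have "transpose A ** A ** pseudoinverse A = transpose A"
    by (simp add: full_rank_pseudoinverse[OF assms] matrix_mul_assoc)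
  then show ?thesis
    by (simp add: matrix_vector_mult_diff_distrib matrix_vector_mul_assoc matrix_mul_assoc)
qed

text \<open>The residual at \<open>xs\<close> is orthogonal to the range of A, so Pythagoras splits
  the objective into its value at \<open>xs\<close> and the squared norm of A (z - xs). Injectivity
  of A makes the minimizer unique.\<close>

lemma normal_equations_least_squares:
  fixes A :: "real^'n^'m"
  assumes rank: "rank A = CARD('n)" and normal: "transpose A *v (b - A *v xs) = 0"
  shows "is_arg_min (\<lambda>z. (norm (b - A *v z))\<^sup>2) (\<lambda>z. True) y \<longleftrightarrow> y = xs"
proof -
  have pyth: "(norm (b - A *v z))\<^sup>2 = (norm (b - A *v xs))\<^sup>2 + (norm (A *v (z - xs)))\<^sup>2" for z
  proof -
    have "(b - A *v xs) \<bullet> (A *v (z - xs)) = 0"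
      using normal by (metis dot_lmul_matrix inner_zero_left transpose_matrix_vector)
    then have "(norm (b - A *v xs - A *v (z - xs)))\<^sup>2 = (norm (b - A *v xs))\<^sup>2 + (norm (A *v (z - xs)))\<^sup>2"
      using dot_norm_neg[of "b - A *v xs" "A *v (z - xs)"] by simp
    then show ?thesis
      by (simp add: matrix_vector_mult_diff_distrib)
  qed
  have "0 < (norm (A *v (z - xs)))\<^sup>2 \<longleftrightarrow> z \<noteq> xs" for z
    by (simp add: full_rank_mult_eq_0[OF rank])
  then show ?thesis
    unfolding is_arg_min_def
    using pyth[of y] pyth[of xs]
    by (smt (verit) pyth zero_le_power2)
qed

section \<open>One step of the greedy Gauss-Seidel method\<close>

lemma GGS_index_set_nonempty: "GGS_index_set A b x \<noteq> {}"
proof -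
  have "Max (range (\<lambda>j. \<bar>column j A \<bullet> (b - A *v x)\<bar>)) \<in> range (\<lambda>j. \<bar>column j A \<bullet> (b - A *v x)\<bar>)"
    by (intro Max_in) auto
  then show ?thesis unfolding GGS_index_set_def by (auto simp: image_iff)
qed

lemma GGS_index_set_maximal:
  assumes "j \<in> GGS_index_set A b x"
  shows "\<bar>column i A \<bullet> (b - A *v x)\<bar> \<le> \<bar>column j A \<bullet> (b - A *v x)\<bar>"
  using assms unfolding GGS_index_set_def by (auto intro!: Max_ge)

lemma GGS_step_exact:
  fixes A :: "real^'n^'m"
  assumes rank: "rank A = CARD('n)" and normal: "transpose A *v (b - A *v xs) = 0"
    and step: "GGS_step A b x x'"
  obtains j where "j \<in> GGS_index_set A b x"
    and "column j A \<bullet> (b - A *v x') = 0"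
    and "(norm (A *v (x' - xs)))\<^sup>2
         = (norm (A *v (x - xs)))\<^sup>2 - (column j A \<bullet> (b - A *v x))\<^sup>2 / (norm (column j A))\<^sup>2"
proof -
  obtain j where j: "j \<in> GGS_index_set A b x"
    and x': "x' = x + ((column j A \<bullet> (b - A *v x)) / (norm (column j A))\<^sup>2) *\<^sub>R axis j 1"
    using step unfolding GGS_step_def is_arg_max_def by blast
  define a where "a = column j A"
  define t where "t = (a \<bullet> (b - A *v x)) / (norm a)\<^sup>2"
  have a: "a \<bullet> a \<noteq> 0"
    using full_rank_column_nonzero[OF rank] by (simp add: a_def)
  have Ax': "A *v x' = A *v x + t *\<^sub>R a"
    by (simp add: x' t_def a_def matrix_vector_right_distrib matrix_vector_mult_scaleR matrix_vector_mult_basis)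
  have t: "t * (a \<bullet> a) = a \<bullet> (b - A *v x)"
    using a by (simp add: t_def power2_norm_eq_inner)
  have zero: "a \<bullet> (b - A *v x') = 0"
    using t by (simp add: Ax' inner_diff_right inner_add_right)
  have "a \<bullet> (b - A *v xs) = 0"
    using normal transpose_mult_component[of A "b - A *v xs" j] by (simp add: a_def)
  \<comment> \<open>The normal equations express the cross term through the step length. In the
    expanded square it contributes -2 t^2 (a . a), which together with + t^2 (a . a) leaves exactly
    the claimed decrease.\<close>
  then have ae: "a \<bullet> (A *v (x - xs)) = - (t * (a \<bullet> a))"
    by (simp add: t matrix_vector_mult_diff_distrib inner_diff_right)
  have "A *v (x' - xs) = A *v (x - xs) + t *\<^sub>R a"
    by (simp add: Ax' matrix_vector_mult_diff_distrib)
  then have "(norm (A *v (x' - xs)))\<^sup>2 = (norm (A *v (x - xs)))\<^sup>2 + 2 * t * (a \<bullet> (A *v (x - xs))) + t\<^sup>2 * (a \<bullet> a)"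
    using dot_norm[of "A *v (x - xs)" "t *\<^sub>R a"]
    by (simp add: inner_commute power_mult_distrib dot_square_norm)
  also have "\<dots> = (norm (A *v (x - xs)))\<^sup>2 - (t * (a \<bullet> a))\<^sup>2 / (a \<bullet> a)"
    using a by (simp add: ae power2_eq_square field_simps)
  finally have "(norm (A *v (x' - xs)))\<^sup>2
      = (norm (A *v (x - xs)))\<^sup>2 - (a \<bullet> (b - A *v x))\<^sup>2 / (norm a)\<^sup>2"
    by (simp only: t power2_norm_eq_inner)
  with j zero show thesis unfolding a_def by (rule that)
qed

text \<open>The set S contains every coordinate at which the gradient is nonzero. Since j has the
  largest entry, the squared gradient norm is at most \<open>card S\<close> times the square of that
  entry. Keeping S general covers both the first step, with all n coordinates, and later steps, with
  n - 1.\<close>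

lemma GGS_step_contraction:
  fixes A :: "real^'n^'m"
  assumes rank: "rank A = CARD('n)" and normal: "transpose A *v (b - A *v xs) = 0"
    and step: "GGS_step A b x x'"
    and S: "S \<noteq> {}" "\<And>i. i \<notin> S \<Longrightarrow> column i A \<bullet> (b - A *v x) = 0"
  defines "R \<equiv> GGS_index_set A b x"
  shows "(norm (A *v (x' - xs)))\<^sup>2
    \<le> (1 - lambda_min (transpose A ** A)
            / (real (card R) * (\<Sum>j\<in>R. (norm (column j A))\<^sup>2) * real (card S)))
        * (norm (A *v (x - xs)))\<^sup>2"
proof -
  define g where "g i = column i A \<bullet> (b - A *v x)" for i
  define \<sigma> where "\<sigma> = (\<Sum>j\<in>R. (norm (column j A))\<^sup>2)"
  define E where "E = (norm (A *v (x - xs)))\<^sup>2"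
  define l where "l = lambda_min (transpose A ** A)"
  obtain j where j: "j \<in> R" and E': "(norm (A *v (x' - xs)))\<^sup>2 = E - (g j)\<^sup>2 / (norm (column j A))\<^sup>2"
    using GGS_step_exact[OF rank normal step] unfolding E_def g_def R_def by metis
  have "transpose A *v (b - A *v x) = - (transpose A *v (A *v (x - xs)))"
    using normal by (simp add: matrix_vector_mult_diff_distrib)
  then have "l * E \<le> (norm (transpose A *v (b - A *v x)))\<^sup>2"
    using lambda_min_gram_le_gradient[OF rank, of "x - xs"] by (simp add: l_def E_def)
  also have "\<dots> = (\<Sum>i\<in>UNIV. (g i)\<^sup>2)"
    unfolding power2_norm_eq_inner inner_vec_def[where 'b='n] transpose_mult_component
    by (simp add: g_def power2_eq_square)
  also have "\<dots> = (\<Sum>i\<in>S. (g i)\<^sup>2)"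
    by (rule sum.mono_neutral_right) (auto simp: g_def S(2))
  also have "\<dots> \<le> real (card S) * (g j)\<^sup>2"
    by (rule sum_bounded_above)
      (use GGS_index_set_maximal j in \<open>auto simp: g_def R_def abs_le_square_iff[symmetric]\<close>)
  finally have lE: "l * E \<le> real (card S) * (g j)\<^sup>2" .
  have s: "0 < real (card S)" using S(1) by (simp add: card_gt_0_iff)
  have R: "1 \<le> real (card R)" using j by (simp add: Suc_le_eq card_gt_0_iff) auto
  have aj: "0 < (norm (column j A))\<^sup>2" using full_rank_column_nonzero[OF rank] by simp
  have \<sigma>: "(norm (column j A))\<^sup>2 \<le> \<sigma>"
    unfolding \<sigma>_def using j by (intro member_le_sum) auto
  with aj have \<sigma>0: "0 < \<sigma>" by linarith
  have "l * E / (real (card R) * \<sigma> * real (card S)) = (l * E / real (card S)) / (real (card R) * \<sigma>)"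
    by simp
  also have "\<dots> \<le> (g j)\<^sup>2 / (real (card R) * \<sigma>)"
    using lE s \<sigma>0 by (intro divide_right_mono) (simp_all add: divide_le_eq mult.commute)
  \<comment> \<open>The product \<open>card R\<close> times \<sigma> enters as an upper bound for
    the squared norm of column j: j lies in R and \<open>card R\<close> is at least 1.\<close>
  also have "\<dots> \<le> (g j)\<^sup>2 / (norm (column j A))\<^sup>2"
  proof (rule divide_left_mono)
    show "(norm (column j A))\<^sup>2 \<le> real (card R) * \<sigma>"
      using R \<sigma> mult_mono[of 1 "real (card R)" "(norm (column j A))\<^sup>2" \<sigma>] by simp
    show "0 < real (card R) * \<sigma> * (norm (column j A))\<^sup>2"
      using R \<sigma>0 aj by (intro mult_pos_pos) linarith+
  qed simp
  finally show ?thesis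
    unfolding E' by (simp add: E_def[symmetric] \<sigma>_def[symmetric] l_def[symmetric] left_diff_distrib)
qed

section \<open>Error bounds along the whole sequence and linear convergence\<close>

theorem theorem1:
  fixes A :: "real^'n^'m" and b :: "real^'m" and x_star x0 :: "real^'n"
    and x :: "nat \<Rightarrow> real^'n" and R :: "nat \<Rightarrow> 'n set" and \<alpha> :: nat and \<beta> :: real
  assumes n_ge_2: "CARD('n) \<ge> 2"
    and full_column_rank: "rank A = CARD('n)"
    and x_star: "x_star = pseudoinverse A *v b"
    and GGS: "GGS_sequence A b x0 x"
    and R: "\<And>k. R k = GGS_index_set A b (x k)"
    and \<alpha>: "\<alpha> = Max (range (\<lambda>k. card (R k)))"
    and \<beta>: "\<beta> = Max (range (\<lambda>k. \<Sum>j\<in>R k. (norm (column j A))\<^sup>2))"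
  shows "x_star = (matrix_inv (transpose A ** A) ** transpose A) *v b \<and>
    (\<forall>y. is_arg_min (\<lambda>z. (norm (b - A *v z))\<^sup>2) (\<lambda>z. True) y \<longleftrightarrow> y = x_star) \<and>
    converges_linearly (energy_norm (transpose A ** A)) x x_star \<and>
    (energy_norm (transpose A ** A) (x 1 - x_star))\<^sup>2
           \<le> (1 - 1 / real (card (R 0)) * (1 / (\<Sum>j\<in>R 0. (norm (column j A))\<^sup>2))
                  * (1 / real CARD('n)) * lambda_min (transpose A ** A))
             * (energy_norm (transpose A ** A) (x0 - x_star))\<^sup>2 \<and>
    (\<forall>k\<ge>1. (energy_norm (transpose A ** A) (x (k + 1) - x_star))\<^sup>2
           \<le> (1 - 1 / real (card (R k)) * (1 / (\<Sum>j\<in>R k. (norm (column j A))\<^sup>2))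
                  * (1 / (real CARD('n) - 1)) * lambda_min (transpose A ** A))
             * (energy_norm (transpose A ** A) (x k - x_star))\<^sup>2) \<and>
    (\<forall>k\<ge>1. (energy_norm (transpose A ** A) (x k - x_star))\<^sup>2
           \<le> (1 - lambda_min (transpose A ** A) / (real \<alpha> * \<beta> * (real CARD('n) - 1))) ^ (k - 1)
             * (1 - lambda_min (transpose A ** A)
                    / (real (card (R 0)) * (\<Sum>j\<in>R 0. (norm (column j A))\<^sup>2) * real CARD('n)))
             * (energy_norm (transpose A ** A) (x0 - x_star))\<^sup>2)"
proof -
  define l where "l = lambda_min (transpose A ** A)"
  define E where "E k = (norm (A *v (x k - x_star)))\<^sup>2" for k
  define \<sigma> where "\<sigma> S = (\<Sum>j\<in>S. (norm (column j A))\<^sup>2)" for S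
  define n where "n = real CARD('n)"
  have n: "2 \<le> n" using n_ge_2 by (simp add: n_def)
  note rank = full_column_rank
  have l0: "0 < l" unfolding l_def by (rule lambda_min_gram(1)[OF rank])
  have normal: "transpose A *v (b - A *v x_star) = 0"
    unfolding x_star by (rule full_rank_normal_equations[OF rank])
  have step: "GGS_step A b (x k) (x (Suc k))" for k
    using GGS unfolding GGS_sequence_def by blast
  have x0: "x 0 = x0" using GGS unfolding GGS_sequence_def by blast
  have R_ne: "R k \<noteq> {}" for k unfolding R by (rule GGS_index_set_nonempty)
  then have card_R: "1 \<le> real (card (R k))" for k
    by (simp add: Suc_le_eq card_gt_0_iff)
  have \<sigma>_ge: "l \<le> \<sigma> (R k)" for k
  proof -
    obtain j where "j \<in> R k" using R_ne by blast
    then have "(norm (column j A))\<^sup>2 \<le> \<sigma> (R k)"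
      unfolding \<sigma>_def by (intro member_le_sum) auto
    then show ?thesis
      using lambda_min_gram_le_column[OF rank, of j] by (simp add: l_def)
  qed
  have E0: "0 \<le> E k" for k by (simp add: E_def)

  have any: "E (Suc k) \<le> (1 - l / (real (card (R k)) * \<sigma> (R k) * n)) * E k" for k
    using GGS_step_contraction[OF rank normal step, of UNIV k]
    by (simp add: E_def l_def \<sigma>_def n_def R)
  have later: "E (Suc (Suc k)) \<le> (1 - l / (real (card (R (Suc k))) * \<sigma> (R (Suc k)) * (n - 1))) * E (Suc k)" for k
  proof -
    \<comment> \<open>The coordinate updated in the previous step now has zero gradient entry, so it
      can be left out of S. With n at least 2 the remaining set is nonempty.\<close>
    obtain j where j: "column j A \<bullet> (b - A *v x (Suc k)) = 0"
      using GGS_step_exact[OF rank normal step] by metis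
    have card: "real (card (UNIV - {j})) = n - 1"
      using n_ge_2 by (simp add: n_def of_nat_diff)
    then have "UNIV - {j} \<noteq> {}" using n by force
    then show ?thesis
      using GGS_step_contraction[OF rank normal step, of "UNIV - {j}" "Suc k"] j card
      by (simp add: E_def l_def \<sigma>_def R)
  qed

  \<comment> \<open>There are only finitely many subsets of the index type, so the maxima over all k
    that define \<alpha> and \<beta> are taken over finite sets and really are upper bounds.\<close>
  have fin: "finite (range (\<lambda>k. f (R k)))" for f :: "'n set \<Rightarrow> 'c"
    using finite_subset[of "range (\<lambda>k. f (R k))" "range f"] by auto
  have \<alpha>_ge: "real (card (R k)) \<le> real \<alpha>" for k
    unfolding \<alpha> by (simp add: fin)
  have \<beta>_ge: "\<sigma> (R k) \<le> \<beta>" for k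
    unfolding \<beta> \<sigma>_def by (intro Max_ge fin[of "\<lambda>S. \<Sum>j\<in>S. (norm (column j A))\<^sup>2"]) auto
  define c where "c = l / (real \<alpha> * \<beta> * (n - 1))"
  have c_le: "c \<le> l / (real (card (R k)) * \<sigma> (R k) * (n - 1))" for k
    unfolding c_def using \<alpha>_ge[of k] \<beta>_ge[of k] \<sigma>_ge[of k] card_R[of k] l0 n
    by (intro divide_left_mono mult_right_mono mult_mono mult_pos_pos) auto
  \<comment> \<open>The induction below multiplies its hypothesis by 1 - c, which must be
    nonnegative. This follows from l \<le> \<sigma> (R 0) \<le> \<beta>, \<alpha> \<ge> 1 and n - 1
    \<ge> 1.\<close>
  have c1: "c \<le> 1"
  proof -
    have "1 * 1 * l \<le> real \<alpha> * (n - 1) * \<beta>"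
      using \<alpha>_ge[of 0] \<beta>_ge[of 0] \<sigma>_ge[of 0] card_R[of 0] l0 n by (intro mult_mono) auto
    then have "l \<le> real \<alpha> * \<beta> * (n - 1)" by (simp add: mult_ac)
    with l0 show ?thesis unfolding c_def by (simp add: divide_le_eq)
  qed
  have uniform: "E (Suc k) \<le> (1 - c) ^ k * (1 - l / (real (card (R 0)) * \<sigma> (R 0) * n)) * E 0" for k
  proof (induction k)
    case 0
    show ?case using any[of 0] by simp
  next
    case (Suc k)
    have "E (Suc (Suc k)) \<le> (1 - c) * E (Suc k)"
      using later[of k] c_le[of "Suc k"] E0[of "Suc k"]
      by (meson diff_left_mono mult_right_mono order_trans)
    also have "\<dots> \<le> (1 - c) * ((1 - c) ^ k * (1 - l / (real (card (R 0)) * \<sigma> (R 0) * n)) * E 0)"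
      using Suc c1 by (intro mult_left_mono) auto
    finally show ?case by (simp add: mult.assoc)
  qed

  have lin: "converges_linearly (energy_norm (transpose A ** A)) x x_star"
  proof -
    \<comment> \<open>A single factor must serve every step including the first, so the bound with n
      is used, and \<open>card (R k)\<close> and \<sigma> (R k) are replaced by their values on the
      full index set.\<close>
    define d where "d = l / (n * \<sigma> UNIV * n)"
    have d_le: "d \<le> l / (real (card (R k)) * \<sigma> (R k) * n)" for k
    proof -
      have "real (card (R k)) \<le> n" unfolding n_def by (simp add: card_mono)
      moreover have "\<sigma> (R k) \<le> \<sigma> UNIV" unfolding \<sigma>_def by (intro sum_mono2) auto
      ultimately show ?thesis
        unfolding d_def using \<sigma>_ge[of k] card_R[of k] l0 n
        by (intro divide_left_mono mult_right_mono mult_mono mult_pos_pos) auto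
    qed
    have "\<sigma> (R 0) \<le> \<sigma> UNIV" unfolding \<sigma>_def by (intro sum_mono2) auto
    then have d0: "0 < d" unfolding d_def using l0 n \<sigma>_ge[of 0] by auto
    \<comment> \<open>The root passes from squared norms to norms. The maximum with 0 makes its
      argument nonnegative without a separate proof of d \<le> 1.\<close>
    define q where "q = sqrt (max 0 (1 - d))"
    have q: "0 \<le> q" "q < 1" unfolding q_def using d0 by auto
    have qE: "norm (A *v (x (Suc k) - x_star)) \<le> q * norm (A *v (x k - x_star))" for k
    proof -
      have "E (Suc k) \<le> max 0 (1 - d) * E k"
        using any[of k] d_le[of k] E0[of k]
        by (smt (verit) mult_right_mono)
      then have "sqrt (E (Suc k)) \<le> sqrt (max 0 (1 - d) * E k)" by simp
      then show ?thesis by (simp add: E_def q_def real_sqrt_mult)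
    qed
    have bound: "norm (A *v (x k - x_star)) \<le> q ^ k * norm (A *v (x 0 - x_star))" for k
    proof (induction k)
      case (Suc k)
      then show ?case
        using qE[of k] q(1) by (smt (verit) mult.assoc mult_left_mono power_Suc)
    qed simp
    have "(\<lambda>k. q ^ k * norm (A *v (x 0 - x_star))) \<longlonglongrightarrow> 0"
      using q by (intro tendsto_mult_left_zero LIMSEQ_realpow_zero)
    then have "(\<lambda>k. (q ^ k * norm (A *v (x 0 - x_star))) / sqrt l) \<longlonglongrightarrow> 0"
      using tendsto_divide_zero by blast
    \<comment> \<open>Convergence in \<open>converges_linearly\<close> refers to the Euclidean norm;
      the eigenvalue bound transfers the geometric decay to it from the energy norm.\<close>
    moreover have "norm (x k - x_star) \<le> (q ^ k * norm (A *v (x 0 - x_star))) / sqrt l" for k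
    proof -
      have "sqrt (l * (norm (x k - x_star))\<^sup>2) \<le> sqrt ((norm (A *v (x k - x_star)))\<^sup>2)"
        using lambda_min_gram(2)[OF rank, of "x k - x_star"] unfolding l_def
        by (rule real_sqrt_le_mono)
      then have "norm (x k - x_star) * sqrt l \<le> norm (A *v (x k - x_star))"
        by (simp add: real_sqrt_mult mult.commute)
      then show ?thesis using bound[of k] l0 by (simp add: le_divide_eq)
    qed
    ultimately have "(\<lambda>k. x k - x_star) \<longlonglongrightarrow> 0"
      by (intro Lim_null_comparison[of "\<lambda>k. x k - x_star"]) auto
    then have "x \<longlonglongrightarrow> x_star" by (simp add: LIM_zero_iff)
    then show ?thesis
      unfolding converges_linearly_def energy_norm_gram using q qE by blast
  qed

  have "(energy_norm (transpose A ** A) (x k - x_star))\<^sup>2 = E k" for k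
    by (simp add: energy_norm_gram E_def)
  note En = this this[of 0, unfolded x0]
  show ?thesis
    unfolding En l_def[symmetric] n_def[symmetric] \<sigma>_def[symmetric] c_def[symmetric]
  proof (intro conjI allI impI)
    show "x_star = (matrix_inv (transpose A ** A) ** transpose A) *v b"
      by (simp add: x_star full_rank_pseudoinverse[OF rank])
    show "is_arg_min (\<lambda>z. (norm (b - A *v z))\<^sup>2) (\<lambda>z. True) y \<longleftrightarrow> y = x_star" for y
      by (rule normal_equations_least_squares[OF rank normal])
    show "converges_linearly (energy_norm (transpose A ** A)) x x_star" by (rule lin)
    show "E 1 \<le> (1 - 1 / real (card (R 0)) * (1 / \<sigma> (R 0)) * (1 / n) * l) * E 0"
      using any[of 0] by simp
    show "E (k + 1) \<le> (1 - 1 / real (card (R k)) * (1 / \<sigma> (R k)) * (1 / (n - 1)) * l) * E k"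
      if "1 \<le> k" for k
      using later[of "k - 1"] that by simp
    show "E k \<le> (1 - c) ^ (k - 1) * (1 - l / (real (card (R 0)) * \<sigma> (R 0) * n)) * E 0"
      if "1 \<le> k" for k
      using uniform[of "k - 1"] that by simp
  qed
qed

end
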